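(* For all integers $n \geq 1$ and all real $x$ and $y$, \begin{align*} -\frac{B_n(x)}{n} & = \sum_{m=1}^n \sum_{l=1}^m \genfrac{\{}{\}}{0pt}{}{n-1}{m-1}_x\genfrac{\{}{\}}{0pt}{}{m-1}{l-1}_y c_m(x) c_{l-1}(y), \\ \frac{B_n(x)}{n} & = \sum_{m=1}^n \sum_{l=1}^m (-1)^m \genfrac{\{}{\}}{0pt}{}{n-1}{m-1}_x\genfrac{\{}{\}}{0pt}{}{m-1}{l-1}_y c_m(x) \widehat{c}_{l-1}(-y), \\ \frac{(-1)^n -B_n(x)}{n} & = \sum_{m=1}^n \sum_{l=1}^m \genfrac{\{}{\}}{0pt}{}{n-1}{m-1}_x\genfrac{\{}{\}}{0pt}{}{m-1}{l-1}_y \widehat{c}_m(-x) c_{l-1}(y), \\ \frac{B_n(x) - (-1)^n}{n} & = \sum_{m=1}^n \sum_{l=1}^m (-1)^m \genfrac{\{}{\}}{0pt}{}{n-1}{m-1}_x\genfrac{\{}{\}}{0pt}{}{m-1}{l-1}_y \widehat{c}_m(-x) \widehat{c}_{l-1}(-y), \end{align*} and \begin{align*} B_n(x) & = x^n - n\sum_{m=1}^n \sum_{l=1}^m \genfrac{\{}{\}}{0pt}{}{n-1}{m-1}_x\genfrac{\{}{\}}{0pt}{}{m-1}{l-1}_y c_m \, c_{l-1}(y), \\ B_n(x) & = x^n + n\sum_{m=1}^n \sum_{l=1}^m (-1)^m \genfrac{\{}{\}}{0pt}{}{n-1}{m-1}_x\genfrac{\{}{\}}{0pt}{}{m-1}{l-1}_y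 c_m \, \widehat{c}_{l-1}(-y), \\ B_n(x) & = (x-1)^n - n \sum_{m=1}^n \sum_{l=1}^m \genfrac{\{}{\}}{0pt}{}{n-1}{m-1}_x\genfrac{\{}{\}}{0pt}{}{m-1}{l-1}_y \widehat{c}_m \, c_{l-1}(y), \\ B_n(x) & = (x-1)^n + n \sum_{m=1}^n \sum_{l=1}^m (-1)^m \genfrac{\{}{\}}{0pt}{}{n-1}{m-1}_x\genfrac{\{}{\}}{0pt}{}{m-1}{l-1}_y \widehat{c}_m \, \widehat{c}_{l-1}(-y). \end{align*}
   Context: For real $z$ and integer $n\ge 0$, $\binom{z}{n} = \frac{z(z-1)\cdots(z-n+1)}{n!}$. The Cauchy polynomials of the first and second kind are $c_n(x) = n! \int_{0}^{1} \binom{t - x}{n}\, dt$ and $\widehat{c}_n(x) = n! \int_{0}^{1} \binom{x - t}{n}\, dt$, $n \ge 0$; the Cauchy numbers are $c_n = c_n(0)$ and $\widehat{c}_n=\widehat{c}_n(0)$. $B_n(x)$ are the classical Bernoulli polynomials, $\frac{te^{xt}}{e^t-1}=\sum_{n\ge0}B_n(x)\frac{t^n}{n!}$. The generalized Stirling numbers of the second kind are $\genfrac{\{}{\}}{0pt}{}{n}{m}_x = \sum_{i=0}^{n-m} \binom{n}{i}\genfrac{\{}{\}}{0pt}{}{n-i}{m} x^i$ for $0 \leq m \leq n$ and $x\in\mathbb{R}$, where $\genfrac{\{}{\}}{0pt}{}{n}{m}$ are the ordinary Stirling numbers of the second kind and $x^0=1$. *)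

theory Defs
  imports
    "HOL-Analysis.Analysis"
    "HOL-Computational_Algebra.Formal_Power_Series"
    "HOL-Combinatorics.Stirling"
begin

definition cauchy1_poly :: "nat \<Rightarrow> real \<Rightarrow> real" where
  "cauchy1_poly n x = fact n * integral {0..1} (\<lambda>t. (t - x) gchoose n)"

definition cauchy2_poly :: "nat \<Rightarrow> real \<Rightarrow> real" where
  "cauchy2_poly n x = fact n * integral {0..1} (\<lambda>t. (x - t) gchoose n)"

definition cauchy1 :: "nat \<Rightarrow> real" where
  "cauchy1 n = cauchy1_poly n 0"

definition cauchy2 :: "nat \<Rightarrow> real" where
  "cauchy2 n = cauchy2_poly n 0"

(* The divisor has subdegree 1, so the quotient is an honest formal power series;
   see bernoulli_fps_mult below. *)
definition bernoulli_fps :: "real \<Rightarrow> real fps" where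
  "bernoulli_fps x = fps_X * fps_exp x / (fps_exp 1 - 1)"

definition bernoulli_poly :: "nat \<Rightarrow> real \<Rightarrow> real" where
  "bernoulli_poly n x = fact n * fps_nth (bernoulli_fps x) n"

(* For m > n the truncated n - m is 0 and the only summand, Stirling n m, vanishes. *)
definition gen_Stirling :: "nat \<Rightarrow> nat \<Rightarrow> real \<Rightarrow> real" where
  "gen_Stirling n m x = (\<Sum>i=0..n-m. of_nat (n choose i) * of_nat (Stirling (n - i) m) * x ^ i)"

lemma bernoulli_fps_mult:
  "bernoulli_fps x * (fps_exp 1 - 1) = fps_X * fps_exp x"
proof -
  have nz: "fps_nth (fps_exp 1 - 1 :: real fps) 1 \<noteq> 0"
    by simp
  hence nz': "(fps_exp 1 - 1 :: real fps) \<noteq> 0"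
    by (metis fps_zero_nth)
  have "subdegree (fps_exp 1 - 1 :: real fps) \<le> 1"
    using nz by (rule subdegree_leI)
  moreover have "subdegree (fps_X * fps_exp x :: real fps) \<ge> 1"
    by (rule subdegree_geI) (auto simp: fps_eq_iff)
  ultimately have "(fps_exp 1 - 1 :: real fps) dvd fps_X * fps_exp x"
    using nz' by (simp add: fps_dvd_iff)
  thus ?thesis
    by (simp add: bernoulli_fps_def)
qed

end

theory Submission
  imports Defs
begin

text \<open>
  Newton expansion in falling factorials, shifted by \<open>x\<close>, reads
  \<open>(z + x)^n = (\<Sum>m\<le>n. gen_Stirling n m x * m! * binom z m)\<close>. Integrating it in \<open>z\<close> evaluates
  the inner sums to \<open>1/m\<close> and \<open>(-1)^(m-1)/m\<close>. Summing it once in the sense of finite differences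
  expresses \<open>(B_n(z + x) - B_n(x))/n\<close> through the binomials \<open>binom z m\<close>; since
  \<open>B_n\<close> integrates to \<open>a^n\<close> over \<open>[a, a + 1]\<close>, integrating this evaluates the outer sums.
\<close>

section \<open>Falling-factorial expansions of powers\<close>

lemma power_eq_sum_Stirling:
  fixes z :: "'a::field_char_0"
  shows "(\<Sum>m\<le>n. of_nat (Stirling n m) * (fact m * (z gchoose m))) = z ^ n"
proof (induction n)
  case 0
  show ?case by simp
next
  case (Suc n)
  define F where "F m = fact m * (z gchoose m)" for m
  have F_Suc: "F (Suc m) = (z - of_nat m) * F m" for m
    unfolding F_def gbinomial_mult_fact by (simp add: mult.commute)
  \<comment> \<open>The Stirling recurrence splits the sum in two; the term with m = 0 drops out
    since \<open>Stirling (Suc n) 0 = 0\<close>.\<close>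
  have "(\<Sum>m\<le>Suc n. of_nat (Stirling (Suc n) m) * F m) =
        (\<Sum>m\<le>n. of_nat (Suc m) * of_nat (Stirling n (Suc m)) * F (Suc m))
        + (\<Sum>m\<le>n. of_nat (Stirling n m) * F (Suc m))"
    by (simp only: sum.atMost_Suc_shift Stirling.simps of_nat_add of_nat_mult distrib_right sum.distrib)
       simp
  also have "(\<Sum>m\<le>n. of_nat (Suc m) * of_nat (Stirling n (Suc m)) * F (Suc m)) =
        (\<Sum>m\<le>Suc n. of_nat m * of_nat (Stirling n m) * F m)"
    by (simp add: sum.atMost_Suc_shift del: sum.atMost_Suc of_nat_Suc)
  \<comment> \<open>The top term vanishes because \<open>Stirling n (Suc n) = 0\<close>. After
    \<open>F_Suc\<close>, the multiples of m in the two sums cancel and only the factor z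
    survives.\<close>
  also have "\<dots> = (\<Sum>m\<le>n. of_nat m * of_nat (Stirling n m) * F m)"
    by simp
  also have "\<dots> + (\<Sum>m\<le>n. of_nat (Stirling n m) * F (Suc m)) =
        (\<Sum>m\<le>n. z * (of_nat (Stirling n m) * F m))"
    unfolding sum.distrib [symmetric]
    by (intro sum.cong) (simp_all add: F_Suc algebra_simps)
  also have "\<dots> = z * z ^ n"
    using Suc.IH by (simp add: F_def flip: sum_distrib_left)
  finally show ?case
    by (simp add: F_def)
qed

text \<open>The added terms vanish, since there n - i < m. A range independent of m lets the sums
  over i and m be swapped.\<close>

lemma gen_Stirling_altdef:
  "gen_Stirling n m x = (\<Sum>i\<le>n. of_nat (n choose i) * of_nat (Stirling (n - i) m) * x ^ i)"
  unfolding gen_Stirling_def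
  by (rule sum.mono_neutral_left) auto

text \<open>Expand by the binomial theorem and write each power of z in falling factorials;
  collecting the coefficient of the m-th one produces exactly the defining sum of
  \<open>gen_Stirling n m x\<close>.\<close>

lemma power_add_eq_sum_gen_Stirling:
  "(\<Sum>m\<le>n. gen_Stirling n m x * (fact m * (z gchoose m))) = (z + x) ^ n"
proof -
  have inner: "(\<Sum>m\<le>n. of_nat (Stirling (n - i) m) * (fact m * (z gchoose m))) = z ^ (n - i)"
    for i
  proof -
    have "(\<Sum>m\<le>n. of_nat (Stirling (n - i) m) * (fact m * (z gchoose m))) =
          (\<Sum>m\<le>n - i. of_nat (Stirling (n - i) m) * (fact m * (z gchoose m)))"
      by (rule sum.mono_neutral_right) auto
    then show ?thesis by (simp add: power_eq_sum_Stirling)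
  qed
  have "(\<Sum>m\<le>n. gen_Stirling n m x * (fact m * (z gchoose m))) =
        (\<Sum>m\<le>n. \<Sum>i\<le>n. of_nat (n choose i) * x ^ i *
           (of_nat (Stirling (n - i) m) * (fact m * (z gchoose m))))"
    by (simp add: gen_Stirling_altdef sum_distrib_left sum_distrib_right mult_ac)
  also have "\<dots> = (\<Sum>i\<le>n. of_nat (n choose i) * x ^ i * z ^ (n - i))"
    by (subst sum.swap) (simp add: inner flip: sum_distrib_left)
  also have "\<dots> = (z + x) ^ n"
    by (simp add: binomial_ring add.commute [of z])
  finally show ?thesis .
qed

section \<open>Bernoulli polynomials: difference equation, derivative and unit-interval
  integrals\<close>

lemma bernoulli_fps_add: "bernoulli_fps (x + y) = bernoulli_fps x * fps_exp y"
proof -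
  have nz: "fps_exp 1 - 1 \<noteq> (0 :: real fps)"
    by (metis bernoulli_fps_mult fps_X_neq_zero fps_exp_neq_0 mult_eq_0_iff)
  \<comment> \<open>Both sides equal \<open>fps_X * fps_exp (x + y)\<close>, and the nonzero factor
    can be cancelled.\<close>
  have "bernoulli_fps (x + y) * (fps_exp 1 - 1) = bernoulli_fps x * fps_exp y * (fps_exp 1 - 1)"
    using bernoulli_fps_mult [of x] bernoulli_fps_mult [of "x + y"]
    by (simp add: fps_exp_add_mult mult_ac)
  then show ?thesis using nz by simp
qed

text \<open>Makes the dependence on x explicitly polynomial, with the Bernoulli numbers (divided by
  factorials) as coefficients; this gives polynomiality and termwise differentiation.\<close>

lemma bernoulli_poly_altdef:
  "bernoulli_poly n x = fact n * (\<Sum>k\<le>n. fps_nth (bernoulli_fps 0) k * (x ^ (n - k) / fact (n - k)))"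
  using bernoulli_fps_add [of 0 x]
  by (simp add: bernoulli_poly_def fps_mult_nth atLeast0AtMost)

text \<open>Shifting x by 1 multiplies the generating function by \<open>fps_exp 1\<close>, so the
  difference has the factor \<open>fps_exp 1 - 1\<close>, which cancels the denominator.\<close>

lemma bernoulli_poly_diff:
  fixes x :: real
  shows "bernoulli_poly (Suc n) (x + 1) - bernoulli_poly (Suc n) x = Suc n * x ^ n"
proof -
  have "bernoulli_fps (x + 1) - bernoulli_fps x = fps_X * fps_exp x"
    using bernoulli_fps_mult [of x] bernoulli_fps_add [of x 1] by (simp add: algebra_simps)
  then have "fps_nth (bernoulli_fps (x + 1)) (Suc n) - fps_nth (bernoulli_fps x) (Suc n) = x ^ n / fact n"
    by (simp flip: fps_sub_nth)
  then show ?thesis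
    by (simp add: bernoulli_poly_def mult.assoc flip: right_diff_distrib)
qed

lemma real_polynomial_function_bernoulli_poly: "real_polynomial_function (bernoulli_poly n)"
  unfolding bernoulli_poly_altdef [abs_def]
  by (intro real_polynomial_function.intros(2-4) real_polynomial_function_sum
      real_polynomial_function_divide real_polynomial_function_power
      real_polynomial_function.intros(1) bounded_linear_ident finite_atMost)

lemma DERIV_bernoulli_poly:
  "(bernoulli_poly (Suc n) has_real_derivative (Suc n * bernoulli_poly n x)) (at x)"
proof -
  have "((\<lambda>x. fact (Suc n) * (\<Sum>k\<le>Suc n. fps_nth (bernoulli_fps 0) k * (x ^ (Suc n - k) / fact (Suc n - k))))
      has_real_derivative
      fact (Suc n) * (\<Sum>k\<le>Suc n. fps_nth (bernoulli_fps 0) k *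
        (real (Suc n - k) * x ^ (Suc n - k - 1) / fact (Suc n - k)))) (at x)"
    by (auto intro!: derivative_eq_intros sum.cong)
  \<comment> \<open>The constant term k = Suc n has derivative 0; elsewhere the exponent cancels the
    leading factor of the factorial.\<close>
  also have "(\<Sum>k\<le>Suc n. fps_nth (bernoulli_fps 0) k *
        (real (Suc n - k) * x ^ (Suc n - k - 1) / fact (Suc n - k))) =
      (\<Sum>k\<le>n. fps_nth (bernoulli_fps 0) k * (x ^ (n - k) / fact (n - k)))"
    by (auto simp: Suc_diff_le simp del: of_nat_Suc of_nat_diff intro!: sum.cong)
  finally show ?thesis
    unfolding bernoulli_poly_altdef by (simp add: mult_ac)
qed

text \<open>An antiderivative is \<open>bernoulli_poly (Suc n)\<close> divided by Suc n, and its
  increment over a unit interval is known from \<open>bernoulli_poly_diff\<close>.\<close>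

lemma integral_bernoulli_poly_add: "integral {0..1} (\<lambda>t. bernoulli_poly n (t + a)) = a ^ n"
proof -
  have "((\<lambda>t. bernoulli_poly n (t + a)) has_integral
      (bernoulli_poly (Suc n) (1 + a) / Suc n - bernoulli_poly (Suc n) (0 + a) / Suc n)) {0..1}"
    by (rule fundamental_theorem_of_calculus)
       (auto intro!: derivative_eq_intros DERIV_chain2 [OF DERIV_bernoulli_poly]
          simp flip: has_real_derivative_iff_has_vector_derivative)
  moreover have "bernoulli_poly (Suc n) (1 + a) / Suc n - bernoulli_poly (Suc n) (0 + a) / Suc n = a ^ n"
    using bernoulli_poly_diff [where n = n and x = a]
    by (simp add: add.commute [of 1] del: of_nat_Suc flip: diff_divide_distrib)
  ultimately show ?thesis by (simp add: integral_unique)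
qed

text \<open>As t runs over the unit interval, a - t sweeps [a - 1, a], whose left endpoint
  determines the value.\<close>

lemma integral_bernoulli_poly_diff: "integral {0..1} (\<lambda>t. bernoulli_poly n (a - t)) = (a - 1) ^ n"
proof -
  have "((\<lambda>t. bernoulli_poly n (a - t)) has_integral
      (- bernoulli_poly (Suc n) (a - 1) / Suc n - (- bernoulli_poly (Suc n) (a - 0) / Suc n))) {0..1}"
    by (rule fundamental_theorem_of_calculus)
       (auto intro!: derivative_eq_intros DERIV_chain2 [OF DERIV_bernoulli_poly]
          simp flip: has_real_derivative_iff_has_vector_derivative)
  moreover have "- bernoulli_poly (Suc n) (a - 1) / Suc n - (- bernoulli_poly (Suc n) (a - 0) / Suc n)
      = (a - 1) ^ n"
    using bernoulli_poly_diff [where n = n and x = "a - 1"]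
    by (simp del: of_nat_Suc flip: diff_divide_distrib)
  ultimately show ?thesis by (simp add: integral_unique)
qed

section \<open>Indefinite summation of the shifted Newton expansion\<close>

lemma real_polynomial_function_eqI:
  assumes p: "real_polynomial_function p" and q: "real_polynomial_function q"
    and eq: "\<And>k::nat. p (real k) = q (real k)"
  shows "p = q"
proof -
  obtain a n where an: "(\<lambda>x. p x - q x) = (\<lambda>x. \<Sum>i\<le>n. a i * x ^ i)"
    using real_polynomial_function_diff [OF p q] by (auto simp: real_polynomial_function_iff_sum)
  \<comment> \<open>A polynomial vanishing at all naturals has infinitely many roots, hence only
    zero coefficients.\<close>
  have "range real \<subseteq> {x. (\<Sum>i\<le>n. a i * x ^ i) = 0}"
    using eq an by (auto simp: fun_eq_iff) (metis diff_self)
  then have "infinite {x. (\<Sum>i\<le>n. a i * x ^ i) = 0}"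
    using finite_subset range_inj_infinite inj_of_nat by blast
  then have "\<forall>i\<le>n. a i = 0"
    using polyfun_finite_roots [of a n] by auto
  then show ?thesis
    using an by (auto simp: fun_eq_iff)
qed

lemma real_polynomial_function_gbinomial: "real_polynomial_function (\<lambda>z. z gchoose m)"
proof -
  obtain p where "real_polynomial_function p" "\<And>x. x gchoose m = p x"
    by (rule real_polynomial_function_gchoose [of m]) blast
  then show ?thesis by simp
qed

text \<open>As functions of z, both sides vanish at 0 and have forward difference (z + x)^n, so they
  agree at all naturals and, being polynomials, everywhere.\<close>

lemma bernoulli_poly_add_eq_sum_gbinomial:
  "(\<Sum>m\<le>n. gen_Stirling n m x * (fact m * (z gchoose Suc m))) =
     (bernoulli_poly (Suc n) (z + x) - bernoulli_poly (Suc n) x) / Suc n"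
proof -
  define P where "P z = (\<Sum>m\<le>n. gen_Stirling n m x * (fact m * (z gchoose Suc m)))" for z
  \<comment> \<open>By Pascal's rule, the difference of \<open>z gchoose Suc m\<close> is
    \<open>z gchoose m\<close>.\<close>
  have step: "P (z + 1) - P z = (z + x) ^ n" for z
    unfolding P_def power_add_eq_sum_gen_Stirling [symmetric] gbinomial_Suc_Suc
    by (simp add: distrib_left sum.distrib)
  have "P = (\<lambda>z. (bernoulli_poly (Suc n) (z + x) - bernoulli_poly (Suc n) x) / Suc n)"
  proof (rule real_polynomial_function_eqI)
    show "real_polynomial_function P"
      unfolding P_def
      by (intro real_polynomial_function_sum real_polynomial_function.intros(2-4) real_polynomial_function_gbinomial finite_atMost)
    have "real_polynomial_function (bernoulli_poly (Suc n) \<circ> (\<lambda>z. z + x))"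
      by (intro real_polynomial_function_compose real_polynomial_function_bernoulli_poly
          polynomial_function_add polynomial_function_id polynomial_function_const)
    then show "real_polynomial_function
        (\<lambda>z. (bernoulli_poly (Suc n) (z + x) - bernoulli_poly (Suc n) x) / Suc n)"
      unfolding o_def
      by (intro real_polynomial_function_divide real_polynomial_function_diff
          real_polynomial_function.intros(2))
    show "P (real k) = (bernoulli_poly (Suc n) (real k + x) - bernoulli_poly (Suc n) x) / Suc n" for k
    proof (induction k)
      case 0
      show ?case by (simp add: P_def gbinomial_0_left)
    next
      case (Suc k)
      show ?case
        using step [of "real k"] bernoulli_poly_diff [where n = n and x = "real k + x"] Suc.IH
        by (simp add: field_simps)
    qed
  qed
  then show ?thesis by (metis P_def)
qed

section \<open>Integration of the expansions and evaluation of the single sums\<close>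

lemma integrable_real_polynomial_function_compose:
  fixes g :: "real \<Rightarrow> real"
  assumes p: "real_polynomial_function p" and g: "continuous_on {a..b} g"
  shows "(\<lambda>t. p (g t)) integrable_on {a..b}"
proof (rule integrable_continuous_real)
  show "continuous_on {a..b} (\<lambda>t. p (g t))"
    using continuous_on_compose [OF g continuous_on_polymonial_function [of p]] p
    by (simp add: o_def real_polynomial_function_eq)
qed

text \<open>The maps g and h are kept general to cover both kinds of Cauchy polynomials, and lower
  indices m as well as Suc m.\<close>

lemma integral_sum_gbinomial:
  fixes g :: "real \<Rightarrow> real"
  assumes "continuous_on {a..b} g" "finite A"
  shows "integral {a..b} (\<lambda>t. \<Sum>m\<in>A. c m * (fact m * (g t gchoose h m))) =
    (\<Sum>m\<in>A. c m * (fact m * integral {a..b} (\<lambda>t. g t gchoose h m)))"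
  using assms
  by (subst integral_sum)
     (auto intro!: integrable_on_mult_right integrable_real_polynomial_function_compose
        [OF real_polynomial_function_gbinomial])

lemma integral_power_unit: "integral {0..1} (\<lambda>t::real. t ^ k) = 1 / Suc k"
proof -
  have "((\<lambda>t::real. t ^ k) has_integral (1 ^ Suc k / Suc k - 0 ^ Suc k / Suc k)) {0..1}"
    by (rule fundamental_theorem_of_calculus, simp,
        unfold has_real_derivative_iff_has_vector_derivative [symmetric],
        rule DERIV_cong [OF DERIV_cdivide [OF DERIV_pow]], simp del: of_nat_Suc)
  then show ?thesis by (simp add: integral_unique)
qed

lemma sum_gen_Stirling_cauchy1_poly:
  "(\<Sum>l\<le>k. gen_Stirling k l y * cauchy1_poly l y) = 1 / Suc k"
proof -
  have "(\<Sum>l\<le>k. gen_Stirling k l y * cauchy1_poly l y) = integral {0..1} (\<lambda>t. t ^ k)"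
    \<comment> \<open>At z = t - y the shift by y cancels, leaving (z + y)^k = t^k.\<close>
    using integral_sum_gbinomial [of 0 1 "\<lambda>t. t - y" "{..k}" "\<lambda>l. gen_Stirling k l y" "\<lambda>l. l"]
    by (simp add: cauchy1_poly_def power_add_eq_sum_gen_Stirling continuous_on_diff)
  also have "\<dots> = 1 / Suc k"
    by (rule integral_power_unit)
  finally show ?thesis .
qed

lemma sum_gen_Stirling_cauchy2_poly:
  "(\<Sum>l\<le>k. gen_Stirling k l y * cauchy2_poly l (- y)) = (- 1) ^ k / Suc k"
proof -
  have "(\<Sum>l\<le>k. gen_Stirling k l y * cauchy2_poly l (- y)) = integral {0..1} (\<lambda>t. (- t) ^ k)"
    using integral_sum_gbinomial [of 0 1 "\<lambda>t. - y - t" "{..k}" "\<lambda>l. gen_Stirling k l y" "\<lambda>l. l"]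
    by (simp add: cauchy2_poly_def power_add_eq_sum_gen_Stirling continuous_on_diff)
  also have "\<dots> = (- 1) ^ k / Suc k"
    by (subst power_minus) (simp add: integral_power_unit)
  finally show ?thesis .
qed

lemma sum_gen_Stirling_integral:
  fixes g :: "real \<Rightarrow> real"
  assumes "continuous_on {0..1} g"
  shows "(\<Sum>m\<le>n. gen_Stirling n m x * (fact m * integral {0..1} (\<lambda>t. g t gchoose Suc m))) =
    (integral {0..1} (\<lambda>t. bernoulli_poly (Suc n) (g t + x)) - bernoulli_poly (Suc n) x) / Suc n"
proof -
  have "(\<lambda>t. bernoulli_poly (Suc n) (g t + x)) integrable_on {0..1}"
    by (rule integrable_real_polynomial_function_compose
          [OF real_polynomial_function_bernoulli_poly, of _ _ "\<lambda>t. g t + x"])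
       (intro continuous_intros assms)
  then show ?thesis
    using integral_sum_gbinomial [OF assms, of "{..n}" "\<lambda>m. gen_Stirling n m x" Suc]
    by (simp add: bernoulli_poly_add_eq_sum_gbinomial integral_diff integrable_const_ivl)
qed

text \<open>Dividing by Suc m turns the factorial of Suc m in the Cauchy polynomial into
  \<open>fact m\<close>. The argument w stays free: w = x makes the power vanish, w = 0 leaves a
  power of x.\<close>

lemma sum_gen_Stirling_cauchy1_poly_Suc:
  "(\<Sum>m\<le>n. gen_Stirling n m x * cauchy1_poly (Suc m) w / Suc m) =
     ((x - w) ^ Suc n - bernoulli_poly (Suc n) x) / Suc n"
proof -
  have "(\<Sum>m\<le>n. gen_Stirling n m x * cauchy1_poly (Suc m) w / Suc m) =
    (\<Sum>m\<le>n. gen_Stirling n m x * (fact m * integral {0..1} (\<lambda>t. (t - w) gchoose Suc m)))"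
    by (intro sum.cong) (simp_all add: cauchy1_poly_def del: of_nat_Suc)
  also have "\<dots> = ((x - w) ^ Suc n - bernoulli_poly (Suc n) x) / Suc n"
    using integral_bernoulli_poly_add [of "Suc n" "x - w"]
    by (subst sum_gen_Stirling_integral) (simp_all add: continuous_on_diff algebra_simps)
  finally show ?thesis .
qed

text \<open>Here w = - x yields a power of -1 and w = 0 a power of x - 1.\<close>

lemma sum_gen_Stirling_cauchy2_poly_Suc:
  "(\<Sum>m\<le>n. gen_Stirling n m x * cauchy2_poly (Suc m) w / Suc m) =
     ((x + w - 1) ^ Suc n - bernoulli_poly (Suc n) x) / Suc n"
proof -
  have "(\<Sum>m\<le>n. gen_Stirling n m x * cauchy2_poly (Suc m) w / Suc m) =
    (\<Sum>m\<le>n. gen_Stirling n m x * (fact m * integral {0..1} (\<lambda>t. (w - t) gchoose Suc m)))"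
    by (intro sum.cong) (simp_all add: cauchy2_poly_def del: of_nat_Suc)
  also have "\<dots> = ((x + w - 1) ^ Suc n - bernoulli_poly (Suc n) x) / Suc n"
    using integral_bernoulli_poly_diff [of "Suc n" "x + w"]
    by (subst sum_gen_Stirling_integral) (simp_all add: continuous_on_diff algebra_simps)
  finally show ?thesis .
qed

section \<open>Reduction of the double sums to single sums\<close>

lemma double_sum_cauchy1_poly:
  "(\<Sum>m=1..Suc n. \<Sum>l=1..m. gen_Stirling (Suc n - 1) (m - 1) x * gen_Stirling (m - 1) (l - 1) y
      * f m * cauchy1_poly (l - 1) y) =
   (\<Sum>m\<le>n. gen_Stirling n m x * f (Suc m) / Suc m)"
proof -
  have "(\<Sum>m=1..Suc n. \<Sum>l=1..m. gen_Stirling (Suc n - 1) (m - 1) x * gen_Stirling (m - 1) (l - 1) y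
      * f m * cauchy1_poly (l - 1) y) =
    (\<Sum>m\<le>n. \<Sum>l\<le>m. gen_Stirling n m x * gen_Stirling m l y * f (Suc m) * cauchy1_poly l y)"
    by (simp add: sum.atLeast_Suc_atMost_Suc_shift atLeast0AtMost
        del: sum.cl_ivl_Suc)
  \<comment> \<open>Whatever f is, it factors out of the sum over l, which equals 1 / Suc m; hence y
    disappears.\<close>
  also have "\<dots> = (\<Sum>m\<le>n. gen_Stirling n m x * f (Suc m) * (\<Sum>l\<le>m. gen_Stirling m l y * cauchy1_poly l y))"
    by (simp add: sum_distrib_left mult_ac)
  finally show ?thesis by (simp add: sum_gen_Stirling_cauchy1_poly)
qed

lemma double_sum_cauchy2_poly:
  "(\<Sum>m=1..Suc n. \<Sum>l=1..m. (- 1) ^ m * gen_Stirling (Suc n - 1) (m - 1) x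
      * gen_Stirling (m - 1) (l - 1) y * f m * cauchy2_poly (l - 1) (- y)) =
   - (\<Sum>m\<le>n. gen_Stirling n m x * f (Suc m) / Suc m)"
proof -
  have "(\<Sum>m=1..Suc n. \<Sum>l=1..m. (- 1) ^ m * gen_Stirling (Suc n - 1) (m - 1) x
      * gen_Stirling (m - 1) (l - 1) y * f m * cauchy2_poly (l - 1) (- y)) =
    (\<Sum>m\<le>n. \<Sum>l\<le>m. (- 1) ^ Suc m * gen_Stirling n m x * gen_Stirling m l y * f (Suc m)
      * cauchy2_poly l (- y))"
    by (simp add: sum.atLeast_Suc_atMost_Suc_shift atLeast0AtMost
        del: sum.cl_ivl_Suc)
  also have "\<dots> = (\<Sum>m\<le>n. (- 1) ^ Suc m * gen_Stirling n m x * f (Suc m)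
      * (\<Sum>l\<le>m. gen_Stirling m l y * cauchy2_poly l (- y)))"
    by (simp add: sum_distrib_left sum_negf mult_ac)
  \<comment> \<open>The inner value (-1)^m / Suc m meets the sign (-1)^(m+1), so every term gets the
    same sign -1.\<close>
  also have "\<dots> = (\<Sum>m\<le>n. - (gen_Stirling n m x * f (Suc m) / Suc m))"
    by (intro sum.cong) (simp_all add: sum_gen_Stirling_cauchy2_poly)
  finally show ?thesis by (simp add: sum_negf)
qed

theorem proposition5:
  fixes n :: nat and x y :: real
  assumes "n \<ge> 1"
  shows "- bernoulli_poly n x / real n =
        (\<Sum>m=1..n. \<Sum>l=1..m. gen_Stirling (n - 1) (m - 1) x * gen_Stirling (m - 1) (l - 1) y
           * cauchy1_poly m x * cauchy1_poly (l - 1) y) \<and>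
      bernoulli_poly n x / real n =
        (\<Sum>m=1..n. \<Sum>l=1..m. (-1) ^ m * gen_Stirling (n - 1) (m - 1) x * gen_Stirling (m - 1) (l - 1) y
           * cauchy1_poly m x * cauchy2_poly (l - 1) (- y)) \<and>
      ((-1) ^ n - bernoulli_poly n x) / real n =
        (\<Sum>m=1..n. \<Sum>l=1..m. gen_Stirling (n - 1) (m - 1) x * gen_Stirling (m - 1) (l - 1) y
           * cauchy2_poly m (- x) * cauchy1_poly (l - 1) y) \<and>
      (bernoulli_poly n x - (-1) ^ n) / real n =
        (\<Sum>m=1..n. \<Sum>l=1..m. (-1) ^ m * gen_Stirling (n - 1) (m - 1) x * gen_Stirling (m - 1) (l - 1) y
           * cauchy2_poly m (- x) * cauchy2_poly (l - 1) (- y)) \<and>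
      bernoulli_poly n x = x ^ n - real n *
        (\<Sum>m=1..n. \<Sum>l=1..m. gen_Stirling (n - 1) (m - 1) x * gen_Stirling (m - 1) (l - 1) y
           * cauchy1 m * cauchy1_poly (l - 1) y) \<and>
      bernoulli_poly n x = x ^ n + real n *
        (\<Sum>m=1..n. \<Sum>l=1..m. (-1) ^ m * gen_Stirling (n - 1) (m - 1) x * gen_Stirling (m - 1) (l - 1) y
           * cauchy1 m * cauchy2_poly (l - 1) (- y)) \<and>
      bernoulli_poly n x = (x - 1) ^ n - real n *
        (\<Sum>m=1..n. \<Sum>l=1..m. gen_Stirling (n - 1) (m - 1) x * gen_Stirling (m - 1) (l - 1) y
           * cauchy2 m * cauchy1_poly (l - 1) y) \<and>
      bernoulli_poly n x = (x - 1) ^ n + real n *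
        (\<Sum>m=1..n. \<Sum>l=1..m. (-1) ^ m * gen_Stirling (n - 1) (m - 1) x * gen_Stirling (m - 1) (l - 1) y
           * cauchy2 m * cauchy2_poly (l - 1) (- y))"
proof -
  obtain k where n: "n = Suc k"
    using assms by (cases n) auto
  show ?thesis
    \<comment> \<open>The double-sum lemmas keep \<open>Suc n - 1\<close> unsimplified to match the
      goal literally after n is replaced. The first four identities use w = x or w = - x, the last
      four w = 0.\<close>
    unfolding n double_sum_cauchy1_poly double_sum_cauchy2_poly cauchy1_def cauchy2_def
      sum_gen_Stirling_cauchy1_poly_Suc sum_gen_Stirling_cauchy2_poly_Suc
    by (intro conjI) (simp_all add: diff_divide_distrib right_diff_distrib del: of_nat_Suc power_Suc)
qed

end
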